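(* Let $(\mu_\circ,\eta_\circ,\delta_\circ,\epsilon_\circ)$ and $(\mu_\bullet,\eta_\bullet,\delta_\bullet,\epsilon_\bullet)$ form a GHZ/W-pair on an object $Q$ of a symmetric monoidal category $\mathbf V$, and assume $\{\eta_\bullet,\tau\circ\eta_\bullet\}$ is a plugging set for $Q$. For $\psi:I\to Q$ let $\Phi_\psi:=\mu_\circ\circ(1_Q\otimes\psi)$ and $\Phi_{1/\psi}:=\tau\circ\Phi_\psi\circ\tau$. Then $$\Phi_{1/\psi}\circ\Phi_\psi=(\epsilon_\bullet\circ\psi)\cdot(\epsilon_\bullet\circ\tau\circ\psi)\cdot 1_Q.$$
   Context: Let $(\mathbf V,\otimes,I,\sigma)$ be a symmetric monoidal category; scalars are morphisms $I\to I$ and $s\cdot f$ denotes $s\otimes f$ with $I\otimes X\cong X$. A commutative Frobenius algebra (CFA) on $Q$ is a commutative monoid $(Q,\mu,\eta)$ and cocommutative comonoid $(Q,\delta,\epsilon)$ with $(1\otimes\mu)(\delta\otimes 1)=\delta\mu=(\mu\otimes1)(1\otimes\delta)$. It is special if $\mu\circ\delta=1_Q$, and anti-special if $c\cdot(\mu\circ\delta)=(\mu\circ\delta\circ\eta)\circ(\epsilon\circ\mu\circ\delta)$ where $c=\epsilon\circ\mu\circ\delta\circ\eta$. A GHZ-structure is a special CFA $(\mu_\circ,\eta_\circ,\delta_\circ,\epsilon_\circ)$, a W-structure an anti-special CFA $(\mu_\bullet,\eta_\bullet,\delta_\bullet,\epsilon_\bullet)$, both on $Q$. Define $\tau:=(\epsilon_\bullet\mu_\bullet\otimes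 1_Q)\circ(1_Q\otimes\delta_\circ\eta_\circ):Q\to Q$. They form a GHZ/W-pair if: ($\alpha$) $\tau=(\epsilon_\circ\mu_\circ\otimes 1_Q)\circ(1_Q\otimes\delta_\bullet\eta_\bullet)$; ($\beta$) $\delta_\circ\circ\eta_\bullet=\eta_\bullet\otimes\eta_\bullet$; ($\gamma$) $\delta_\circ\circ\tau=(\tau\otimes\tau)\circ\delta_\circ$; ($\xi$) $(\epsilon_\bullet\mu_\bullet\delta_\bullet\eta_\bullet)\cdot(\tau\circ\eta_\bullet)=\mu_\bullet\circ\delta_\bullet\circ\eta_\bullet$. A set of points $\{\psi_i:I\to Q\}$ is a plugging set if for all objects $A$ and $f,g:Q\to A$, $f=g$ iff $f\circ\psi_i=g\circ\psi_i$ for all $i$. *)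

theory Defs
  imports Main
begin

record ('o, 'm) cat_struct =
  obj :: "'o set"
  arr :: "'m set"
  src :: "'m \<Rightarrow> 'o"
  tgt :: "'m \<Rightarrow> 'o"
  idm :: "'o \<Rightarrow> 'm"
  cmp :: "'m \<Rightarrow> 'm \<Rightarrow> 'm" (infixr "\<odot>\<index>" 55)

definition hom :: "('o, 'm, 'b) cat_struct_scheme \<Rightarrow> 'o \<Rightarrow> 'o \<Rightarrow> 'm set" where
  "hom V A B = {f \<in> arr V. src V f = A \<and> tgt V f = B}"

locale category =
  fixes V :: "('o, 'm, 'b) cat_struct_scheme" (structure)
  assumes src_obj: "f \<in> arr V \<Longrightarrow> src V f \<in> obj V"
    and tgt_obj: "f \<in> arr V \<Longrightarrow> tgt V f \<in> obj V"
    and idm_hom: "A \<in> obj V \<Longrightarrow> idm V A \<in> hom V A A"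
    and cmp_hom: "\<lbrakk>f \<in> hom V A B; g \<in> hom V B C\<rbrakk> \<Longrightarrow> g \<odot> f \<in> hom V A C"
    and cmp_idm_left: "f \<in> hom V A B \<Longrightarrow> idm V B \<odot> f = f"
    and cmp_idm_right: "f \<in> hom V A B \<Longrightarrow> f \<odot> idm V A = f"
    and cmp_assoc: "\<lbrakk>f \<in> hom V A B; g \<in> hom V B C; h \<in> hom V C D\<rbrakk>
        \<Longrightarrow> (h \<odot> g) \<odot> f = h \<odot> (g \<odot> f)"

definition inverse_arrows :: "('o, 'm, 'b) cat_struct_scheme \<Rightarrow> 'm \<Rightarrow> 'm \<Rightarrow> bool" where
  "inverse_arrows V f g \<longleftrightarrow>
     f \<in> arr V \<and> g \<in> hom V (tgt V f) (src V f) \<and>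
     g \<odot>\<^bsub>V\<^esub> f = idm V (src V f) \<and> f \<odot>\<^bsub>V\<^esub> g = idm V (tgt V f)"

definition iso :: "('o, 'm, 'b) cat_struct_scheme \<Rightarrow> 'm \<Rightarrow> bool" where
  "iso V f \<longleftrightarrow> (\<exists>g. inverse_arrows V f g)"

definition inv_arr :: "('o, 'm, 'b) cat_struct_scheme \<Rightarrow> 'm \<Rightarrow> 'm" where
  "inv_arr V f = (THE g. inverse_arrows V f g)"

record ('o, 'm) smc_struct = "('o, 'm) cat_struct" +
  tensor_obj :: "'o \<Rightarrow> 'o \<Rightarrow> 'o" (infixl "\<boxtimes>\<index>" 70)
  tensor :: "'m \<Rightarrow> 'm \<Rightarrow> 'm" (infixl "\<otimes>\<index>" 70)
  unit_obj :: "'o" ("\<one>\<index>")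
  assoc :: "'o \<Rightarrow> 'o \<Rightarrow> 'o \<Rightarrow> 'm"
  lunit :: "'o \<Rightarrow> 'm"
  runit :: "'o \<Rightarrow> 'm"
  braid :: "'o \<Rightarrow> 'o \<Rightarrow> 'm"

text \<open>Mac Lane's axioms for a (not necessarily strict) symmetric monoidal category. The axioms
  \<open>lunit_eq_runit\<close> and \<open>braid_unit\<close> follow from the others, but are part of his definition.\<close>

locale symmetric_monoidal_category = category V
  for V :: "('o, 'm, 'b) smc_struct_scheme" (structure) +
  assumes unit_obj: "\<one> \<in> obj V"
    and tensor_obj: "\<lbrakk>A \<in> obj V; B \<in> obj V\<rbrakk> \<Longrightarrow> A \<boxtimes> B \<in> obj V"
    and tensor_hom: "\<lbrakk>f \<in> hom V A B; g \<in> hom V C D\<rbrakk> \<Longrightarrow> f \<otimes> g \<in> hom V (A \<boxtimes> C) (B \<boxtimes> D)"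
    and tensor_idm: "\<lbrakk>A \<in> obj V; B \<in> obj V\<rbrakk> \<Longrightarrow> idm V A \<otimes> idm V B = idm V (A \<boxtimes> B)"
    and interchange: "\<lbrakk>f \<in> hom V A B; g \<in> hom V B C; f' \<in> hom V A' B'; g' \<in> hom V B' C'\<rbrakk>
        \<Longrightarrow> (g \<odot> f) \<otimes> (g' \<odot> f') = (g \<otimes> g') \<odot> (f \<otimes> f')"
    and assoc_hom: "\<lbrakk>A \<in> obj V; B \<in> obj V; C \<in> obj V\<rbrakk>
        \<Longrightarrow> assoc V A B C \<in> hom V ((A \<boxtimes> B) \<boxtimes> C) (A \<boxtimes> (B \<boxtimes> C))"
    and assoc_iso: "\<lbrakk>A \<in> obj V; B \<in> obj V; C \<in> obj V\<rbrakk> \<Longrightarrow> iso V (assoc V A B C)"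
    and assoc_natural: "\<lbrakk>f \<in> hom V A A'; g \<in> hom V B B'; h \<in> hom V C C'\<rbrakk>
        \<Longrightarrow> assoc V A' B' C' \<odot> ((f \<otimes> g) \<otimes> h) = (f \<otimes> (g \<otimes> h)) \<odot> assoc V A B C"
    and lunit_hom: "A \<in> obj V \<Longrightarrow> lunit V A \<in> hom V (\<one> \<boxtimes> A) A"
    and lunit_iso: "A \<in> obj V \<Longrightarrow> iso V (lunit V A)"
    and lunit_natural: "f \<in> hom V A B \<Longrightarrow> lunit V B \<odot> (idm V \<one> \<otimes> f) = f \<odot> lunit V A"
    and runit_hom: "A \<in> obj V \<Longrightarrow> runit V A \<in> hom V (A \<boxtimes> \<one>) A"
    and runit_iso: "A \<in> obj V \<Longrightarrow> iso V (runit V A)"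
    and runit_natural: "f \<in> hom V A B \<Longrightarrow> runit V B \<odot> (f \<otimes> idm V \<one>) = f \<odot> runit V A"
    and pentagon: "\<lbrakk>A \<in> obj V; B \<in> obj V; C \<in> obj V; D \<in> obj V\<rbrakk>
        \<Longrightarrow> assoc V A B (C \<boxtimes> D) \<odot> assoc V (A \<boxtimes> B) C D =
            (idm V A \<otimes> assoc V B C D) \<odot> assoc V A (B \<boxtimes> C) D \<odot> (assoc V A B C \<otimes> idm V D)"
    and triangle: "\<lbrakk>A \<in> obj V; B \<in> obj V\<rbrakk>
        \<Longrightarrow> (idm V A \<otimes> lunit V B) \<odot> assoc V A \<one> B = runit V A \<otimes> idm V B"
    and lunit_eq_runit: "lunit V \<one> = runit V \<one>"
    and braid_hom: "\<lbrakk>A \<in> obj V; B \<in> obj V\<rbrakk> \<Longrightarrow> braid V A B \<in> hom V (A \<boxtimes> B) (B \<boxtimes> A)"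
    and braid_natural: "\<lbrakk>f \<in> hom V A A'; g \<in> hom V B B'\<rbrakk>
        \<Longrightarrow> braid V A' B' \<odot> (f \<otimes> g) = (g \<otimes> f) \<odot> braid V A B"
    and braid_braid: "\<lbrakk>A \<in> obj V; B \<in> obj V\<rbrakk> \<Longrightarrow> braid V B A \<odot> braid V A B = idm V (A \<boxtimes> B)"
    and braid_unit: "A \<in> obj V \<Longrightarrow> lunit V A \<odot> braid V A \<one> = runit V A"
    and hexagon: "\<lbrakk>A \<in> obj V; B \<in> obj V; C \<in> obj V\<rbrakk>
        \<Longrightarrow> assoc V B C A \<odot> braid V A (B \<boxtimes> C) \<odot> assoc V A B C =
            (idm V B \<otimes> braid V A C) \<odot> assoc V B A C \<odot> (braid V A B \<otimes> idm V C)"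

text \<open>The action \<open>s \<cdot> f\<close> of a scalar, i.e. \<open>s \<otimes> f\<close> transported along \<open>I \<otimes> X \<cong> X\<close>.\<close>

definition scalar_mult :: "('o, 'm, 'b) smc_struct_scheme \<Rightarrow> 'm \<Rightarrow> 'm \<Rightarrow> 'm"
    (infixr "\<cdot>\<index>" 65) where
  "s \<cdot>\<^bsub>V\<^esub> f =
     lunit V (tgt V f) \<odot>\<^bsub>V\<^esub> (s \<otimes>\<^bsub>V\<^esub> f) \<odot>\<^bsub>V\<^esub> inv_arr V (lunit V (src V f))"

record 'm frob_struct =
  mu :: "'m"
  eta :: "'m"
  delta :: "'m"
  eps :: "'m"

locale comm_frobenius_algebra = symmetric_monoidal_category V
  for V :: "('o, 'm, 'b) smc_struct_scheme" (structure) +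
  fixes Q :: 'o and F :: "'m frob_struct"
  assumes carrier_obj: "Q \<in> obj V"
    and mu_hom: "mu F \<in> hom V (Q \<boxtimes> Q) Q"
    and eta_hom: "eta F \<in> hom V \<one> Q"
    and delta_hom: "delta F \<in> hom V Q (Q \<boxtimes> Q)"
    and eps_hom: "eps F \<in> hom V Q \<one>"
    and mu_assoc: "mu F \<odot> (mu F \<otimes> idm V Q) = mu F \<odot> (idm V Q \<otimes> mu F) \<odot> assoc V Q Q Q"
    and mu_unit_left: "mu F \<odot> (eta F \<otimes> idm V Q) = lunit V Q"
    and mu_unit_right: "mu F \<odot> (idm V Q \<otimes> eta F) = runit V Q"
    and mu_comm: "mu F \<odot> braid V Q Q = mu F"
    and delta_coassoc:
      "assoc V Q Q Q \<odot> (delta F \<otimes> idm V Q) \<odot> delta F = (idm V Q \<otimes> delta F) \<odot> delta F"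
    and delta_counit_left: "lunit V Q \<odot> (eps F \<otimes> idm V Q) \<odot> delta F = idm V Q"
    and delta_counit_right: "runit V Q \<odot> (idm V Q \<otimes> eps F) \<odot> delta F = idm V Q"
    and delta_cocomm: "braid V Q Q \<odot> delta F = delta F"
    and frobenius_left:
      "(idm V Q \<otimes> mu F) \<odot> assoc V Q Q Q \<odot> (delta F \<otimes> idm V Q) = delta F \<odot> mu F"
    and frobenius_right:
      "(mu F \<otimes> idm V Q) \<odot> inv_arr V (assoc V Q Q Q) \<odot> (idm V Q \<otimes> delta F) = delta F \<odot> mu F"

locale GHZ_structure = comm_frobenius_algebra V Q F
  for V :: "('o, 'm, 'b) smc_struct_scheme" (structure) and Q F +
  assumes special: "mu F \<odot> delta F = idm V Q"

locale W_structure = comm_frobenius_algebra V Q F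
  for V :: "('o, 'm, 'b) smc_struct_scheme" (structure) and Q F +
  assumes anti_special:
    "(eps F \<odot> mu F \<odot> delta F \<odot> eta F) \<cdot> (mu F \<odot> delta F) =
     (mu F \<odot> delta F \<odot> eta F) \<odot> (eps F \<odot> mu F \<odot> delta F)"

text \<open>\<open>cap_cup V Q F G\<close> is \<open>(\<epsilon>\<^sub>F \<mu>\<^sub>F \<otimes> 1) \<circ> (1 \<otimes> \<delta>\<^sub>G \<eta>\<^sub>G)\<close>, with the coherence isomorphisms
  \<open>Q \<rightarrow> Q \<otimes> I\<close>, \<open>Q \<otimes> (Q \<otimes> Q) \<rightarrow> (Q \<otimes> Q) \<otimes> Q\<close> and \<open>I \<otimes> Q \<rightarrow> Q\<close> made explicit.\<close>

definition cap_cup ::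
    "('o, 'm, 'b) smc_struct_scheme \<Rightarrow> 'o \<Rightarrow> 'm frob_struct \<Rightarrow> 'm frob_struct \<Rightarrow> 'm" where
  "cap_cup V Q F G =
     lunit V Q
     \<odot>\<^bsub>V\<^esub> ((eps F \<odot>\<^bsub>V\<^esub> mu F) \<otimes>\<^bsub>V\<^esub> idm V Q)
     \<odot>\<^bsub>V\<^esub> inv_arr V (assoc V Q Q Q)
     \<odot>\<^bsub>V\<^esub> (idm V Q \<otimes>\<^bsub>V\<^esub> (delta G \<odot>\<^bsub>V\<^esub> eta G))
     \<odot>\<^bsub>V\<^esub> inv_arr V (runit V Q)"

definition tau ::
    "('o, 'm, 'b) smc_struct_scheme \<Rightarrow> 'o \<Rightarrow> 'm frob_struct \<Rightarrow> 'm frob_struct \<Rightarrow> 'm" where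
  "tau V Q G W = cap_cup V Q W G"

locale GHZ_W_pair = GHZ: GHZ_structure V Q G + W: W_structure V Q W
  for V :: "('o, 'm, 'b) smc_struct_scheme" (structure) and Q G W +
  assumes alpha: "tau V Q G W = cap_cup V Q G W"
    and beta: "delta G \<odot> eta W = (eta W \<otimes> eta W) \<odot> inv_arr V (lunit V \<one>)"
    and gamma: "delta G \<odot> tau V Q G W = (tau V Q G W \<otimes> tau V Q G W) \<odot> delta G"
    and xi: "(eps W \<odot> mu W \<odot> delta W \<odot> eta W) \<cdot> (tau V Q G W \<odot> eta W) =
             mu W \<odot> delta W \<odot> eta W"

definition plugging_set :: "('o, 'm, 'b) smc_struct_scheme \<Rightarrow> 'o \<Rightarrow> 'm set \<Rightarrow> bool" where
  "plugging_set V Q P \<longleftrightarrow>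
     P \<subseteq> hom V \<one>\<^bsub>V\<^esub> Q \<and>
     (\<forall>A \<in> obj V. \<forall>f \<in> hom V Q A. \<forall>g \<in> hom V Q A.
        f = g \<longleftrightarrow> (\<forall>\<psi> \<in> P. f \<odot>\<^bsub>V\<^esub> \<psi> = g \<odot>\<^bsub>V\<^esub> \<psi>))"

definition Phi :: "('o, 'm, 'b) smc_struct_scheme \<Rightarrow> 'o \<Rightarrow> 'm frob_struct \<Rightarrow> 'm \<Rightarrow> 'm" where
  "Phi V Q G \<psi> = mu G \<odot>\<^bsub>V\<^esub> (idm V Q \<otimes>\<^bsub>V\<^esub> \<psi>) \<odot>\<^bsub>V\<^esub> inv_arr V (runit V Q)"

definition Phi_inv ::
    "('o, 'm, 'b) smc_struct_scheme \<Rightarrow> 'o \<Rightarrow> 'm frob_struct \<Rightarrow> 'm frob_struct \<Rightarrow> 'm \<Rightarrow> 'm" where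
  "Phi_inv V Q G W \<psi> = tau V Q G W \<odot>\<^bsub>V\<^esub> Phi V Q G \<psi> \<odot>\<^bsub>V\<^esub> tau V Q G W"

end

theory Submission
  imports Defs
begin

text \<open>Evaluated at a plugging point, both sides become scalar multiples of that point. The points
  \<open>\<eta>\<^sub>\<bullet>\<close> and \<open>\<tau> \<eta>\<^sub>\<bullet>\<close> are copied by \<open>\<delta>\<^sub>\<circ>\<close>, so by the Frobenius law they are eigenvectors of \<open>\<Phi>\<^sub>\<psi>\<close>,
  the eigenvalue of \<open>p\<close> being \<open>\<epsilon>\<^sub>\<circ> \<mu>\<^sub>\<circ> (p \<otimes> \<psi>)\<close>. By (\<open>\<alpha>\<close>) composition with \<open>\<tau>\<close> exchanges the pairings
  \<open>\<epsilon>\<^sub>\<circ> \<mu>\<^sub>\<circ>\<close> and \<open>\<epsilon>\<^sub>\<bullet> \<mu>\<^sub>\<bullet>\<close>; hence the two eigenvalues are \<open>\<epsilon>\<^sub>\<bullet> \<tau> \<psi>\<close> and \<open>\<epsilon>\<^sub>\<bullet> \<psi>\<close>, and \<open>\<tau>\<close> is an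
  involution. Thus \<open>\<tau>\<close> swaps the two eigenvectors, and \<open>\<tau> \<Phi>\<^sub>\<psi> \<tau> \<Phi>\<^sub>\<psi>\<close> multiplies each of them by the
  product of the eigenvalues.\<close>

section \<open>Categories\<close>

context category
begin

lemma homD: "f \<in> hom V A B \<Longrightarrow> f \<in> arr V \<and> src V f = A \<and> tgt V f = B \<and> A \<in> obj V \<and> B \<in> obj V"
  using src_obj tgt_obj by (auto simp: hom_def)

lemma idm_arr [simp]:
  assumes "A \<in> obj V"
  shows "idm V A \<in> arr V" "src V (idm V A) = A" "tgt V (idm V A) = A"
  using homD[OF idm_hom[OF assms]] by auto

lemma cmp_arr [simp]:
  assumes "f \<in> arr V" "g \<in> arr V" "tgt V f = src V g"
  shows "g \<odot> f \<in> arr V" "src V (g \<odot> f) = src V f" "tgt V (g \<odot> f) = tgt V g"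
  using cmp_hom[of f "src V f" "tgt V f" g "tgt V g"] assms by (auto simp: hom_def)

lemma cmp_idm_arr [simp]:
  "\<lbrakk>f \<in> arr V; tgt V f = B\<rbrakk> \<Longrightarrow> idm V B \<odot> f = f"
  "\<lbrakk>f \<in> arr V; src V f = A\<rbrakk> \<Longrightarrow> f \<odot> idm V A = f"
  using cmp_idm_left cmp_idm_right by (auto simp: hom_def)

lemma cmp_assoc_arr [simp]:
  "\<lbrakk>f \<in> arr V; g \<in> arr V; h \<in> arr V; tgt V f = src V g; tgt V g = src V h\<rbrakk>
    \<Longrightarrow> (h \<odot> g) \<odot> f = h \<odot> (g \<odot> f)"
  using cmp_assoc[of f "src V f" "tgt V f" g "tgt V g" h "tgt V h"] by (simp add: hom_def)

lemma cmp_reassoc: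
  "\<lbrakk>g \<odot> f = h; k \<in> arr V; f \<in> arr V; g \<in> arr V; tgt V k = src V f; tgt V f = src V g\<rbrakk>
    \<Longrightarrow> g \<odot> (f \<odot> k) = h \<odot> k"
  by (metis cmp_assoc_arr)

lemma inverse_arrows_unique:
  assumes g: "inverse_arrows V f g" and h: "inverse_arrows V f h"
  shows "g = h"
proof -
  have "h = h \<odot> (f \<odot> g)"
    using g h by (simp add: inverse_arrows_def hom_def)
  also have "\<dots> = (h \<odot> f) \<odot> g"
    by (rule cmp_assoc_arr[symmetric]) (use g h in \<open>auto simp: inverse_arrows_def hom_def\<close>)
  also have "\<dots> = g"
    using g h by (simp add: inverse_arrows_def hom_def del: cmp_assoc_arr)
  finally show ?thesis ..
qed

lemma inverse_arrows_inv_arr: "iso V f \<Longrightarrow> inverse_arrows V f (inv_arr V f)"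
  unfolding iso_def inv_arr_def by (metis inverse_arrows_unique theI)

lemma iso_arr: "iso V f \<Longrightarrow> f \<in> arr V"
  by (auto simp: iso_def inverse_arrows_def)

lemma inv_arr_arr [simp]:
  assumes "iso V f"
  shows "inv_arr V f \<in> arr V" "src V (inv_arr V f) = tgt V f" "tgt V (inv_arr V f) = src V f"
  using inverse_arrows_inv_arr[OF assms] by (auto simp: inverse_arrows_def hom_def)

lemma inv_arr_left [simp]: "iso V f \<Longrightarrow> inv_arr V f \<odot> f = idm V (src V f)"
  and inv_arr_right [simp]: "iso V f \<Longrightarrow> f \<odot> inv_arr V f = idm V (tgt V f)"
  using inverse_arrows_inv_arr by (auto simp: inverse_arrows_def)

lemma inv_arr_cancel [simp]:
  assumes "iso V f" "k \<in> arr V"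
  shows "tgt V k = src V f \<Longrightarrow> inv_arr V f \<odot> (f \<odot> k) = k"
    and "tgt V k = tgt V f \<Longrightarrow> f \<odot> (inv_arr V f \<odot> k) = k"
  using assms by (simp_all add: cmp_reassoc[OF inv_arr_left] cmp_reassoc[OF inv_arr_right] iso_arr)

lemma iso_cancel_left:
  assumes "iso V f" "g \<in> arr V" "h \<in> arr V" "tgt V g = src V f" "tgt V h = src V f" "f \<odot> g = f \<odot> h"
  shows "g = h"
  by (metis assms inv_arr_cancel(1))

lemma iso_cancel_right:
  assumes "iso V f" "g \<in> arr V" "h \<in> arr V" "src V g = tgt V f" "src V h = tgt V f" "g \<odot> f = h \<odot> f"
  shows "g = h"
proof -
  have "g = (g \<odot> f) \<odot> inv_arr V f" and "h = (h \<odot> f) \<odot> inv_arr V f"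
    using assms(1-5) by (simp_all add: iso_arr)
  then show ?thesis
    using assms(6) by metis
qed

lemma inv_arr_natural:
  assumes "iso V a" "iso V b" "f \<in> arr V" "g \<in> arr V"
    and "src V f = src V a" "tgt V f = src V b" "src V g = tgt V a" "tgt V g = tgt V b"
    and "b \<odot> f = g \<odot> a"
  shows "inv_arr V b \<odot> g = f \<odot> inv_arr V a"
proof (rule iso_cancel_left[OF assms(2)])
  have "b \<odot> f \<odot> inv_arr V a = g \<odot> a \<odot> inv_arr V a"
    using assms by (simp add: cmp_reassoc[OF assms(9)] iso_arr)
  then show "b \<odot> inv_arr V b \<odot> g = b \<odot> f \<odot> inv_arr V a"
    using assms by simp
qed (use assms in \<open>simp_all add: iso_arr\<close>)

end

section \<open>Symmetric monoidal categories\<close>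

context symmetric_monoidal_category
begin

declare unit_obj [simp] tensor_obj [simp] assoc_iso [simp] lunit_iso [simp] runit_iso [simp]
  tensor_idm [simp]

lemma tensor_arr [simp]:
  assumes "f \<in> arr V" "g \<in> arr V"
  shows "f \<otimes> g \<in> arr V" "src V (f \<otimes> g) = src V f \<boxtimes> src V g" "tgt V (f \<otimes> g) = tgt V f \<boxtimes> tgt V g"
  using tensor_hom[of f "src V f" "tgt V f" g "src V g" "tgt V g"] assms by (auto simp: hom_def)

lemma coherence_arr [simp]:
  "A \<in> obj V \<Longrightarrow> lunit V A \<in> arr V" "A \<in> obj V \<Longrightarrow> src V (lunit V A) = \<one> \<boxtimes> A"
  "A \<in> obj V \<Longrightarrow> tgt V (lunit V A) = A"
  "A \<in> obj V \<Longrightarrow> runit V A \<in> arr V" "A \<in> obj V \<Longrightarrow> src V (runit V A) = A \<boxtimes> \<one>"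
  "A \<in> obj V \<Longrightarrow> tgt V (runit V A) = A"
  "\<lbrakk>A \<in> obj V; B \<in> obj V\<rbrakk> \<Longrightarrow> braid V A B \<in> arr V"
  "\<lbrakk>A \<in> obj V; B \<in> obj V\<rbrakk> \<Longrightarrow> src V (braid V A B) = A \<boxtimes> B"
  "\<lbrakk>A \<in> obj V; B \<in> obj V\<rbrakk> \<Longrightarrow> tgt V (braid V A B) = B \<boxtimes> A"
  "\<lbrakk>A \<in> obj V; B \<in> obj V; C \<in> obj V\<rbrakk> \<Longrightarrow> assoc V A B C \<in> arr V"
  "\<lbrakk>A \<in> obj V; B \<in> obj V; C \<in> obj V\<rbrakk> \<Longrightarrow> src V (assoc V A B C) = (A \<boxtimes> B) \<boxtimes> C"
  "\<lbrakk>A \<in> obj V; B \<in> obj V; C \<in> obj V\<rbrakk> \<Longrightarrow> tgt V (assoc V A B C) = A \<boxtimes> (B \<boxtimes> C)"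
  using lunit_hom runit_hom braid_hom assoc_hom by (auto simp: hom_def)

lemma interchange_arr:
  "\<lbrakk>f \<in> arr V; g \<in> arr V; f' \<in> arr V; g' \<in> arr V; tgt V f = src V g; tgt V f' = src V g'\<rbrakk>
    \<Longrightarrow> (g \<otimes> g') \<odot> (f \<otimes> f') = (g \<odot> f) \<otimes> (g' \<odot> f')"
  by (rule interchange[symmetric]) (auto simp: hom_def)

lemma interchange_arr_cmp:
  "\<lbrakk>f \<in> arr V; g \<in> arr V; f' \<in> arr V; g' \<in> arr V; k \<in> arr V;
    tgt V f = src V g; tgt V f' = src V g'; tgt V k = src V f \<boxtimes> src V f'\<rbrakk>
    \<Longrightarrow> (g \<otimes> g') \<odot> ((f \<otimes> f') \<odot> k) = ((g \<odot> f) \<otimes> (g' \<odot> f')) \<odot> k"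
  by (rule cmp_reassoc[OF interchange_arr]) simp_all

lemma runit_inv_natural:
  assumes "f \<in> hom V A B"
  shows "inv_arr V (runit V B) \<odot> f = (f \<otimes> idm V \<one>) \<odot> inv_arr V (runit V A)"
  using homD[OF assms] by (intro inv_arr_natural) (simp_all add: runit_natural[OF assms])

lemma lunit_inv_natural:
  assumes "f \<in> hom V A B"
  shows "inv_arr V (lunit V B) \<odot> f = (idm V \<one> \<otimes> f) \<odot> inv_arr V (lunit V A)"
  using homD[OF assms] by (intro inv_arr_natural) (simp_all add: lunit_natural[OF assms])

lemma tensor_unit_faithful:
  assumes "f \<in> hom V A B" "g \<in> hom V A B" "f \<otimes> idm V \<one> = g \<otimes> idm V \<one>"
  shows "f = g"
  using iso_cancel_right[OF runit_iso, of A f g] homD[OF assms(1)] homD[OF assms(2)]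
    runit_natural[OF assms(1)] runit_natural[OF assms(2)] assms(3) by simp

text \<open>Kelly's redundancy argument: after tensoring with the unit object on the right, the claim
  is the pentagon for \<open>A, B, I, I\<close> composed with \<open>1 \<otimes> (1 \<otimes> \<lambda>)\<close>.\<close>

lemma runit_tensor:
  assumes [simp]: "A \<in> obj V" "B \<in> obj V"
  shows "(idm V A \<otimes> runit V B) \<odot> assoc V A B \<one> = runit V (A \<boxtimes> B)"
proof (rule tensor_unit_faithful)
  let ?\<alpha> = "assoc V A B \<one>" and ?\<alpha>' = "assoc V A (B \<boxtimes> \<one>) \<one>"
  have slide_lunit: "?\<alpha> \<odot> (idm V (A \<boxtimes> B) \<otimes> lunit V \<one>)
      = (idm V A \<otimes> (idm V B \<otimes> lunit V \<one>)) \<odot> assoc V A B (\<one> \<boxtimes> \<one>)"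
    using assoc_natural[of "idm V A" A A "idm V B" B B "lunit V \<one>" "\<one> \<boxtimes> \<one>" \<one>]
    by (simp add: hom_def)
  have slide_runit: "?\<alpha> \<odot> ((idm V A \<otimes> runit V B) \<otimes> idm V \<one>)
      = (idm V A \<otimes> (runit V B \<otimes> idm V \<one>)) \<odot> ?\<alpha>'"
    using assoc_natural[of "idm V A" A A "runit V B" "B \<boxtimes> \<one>" B "idm V \<one>" \<one> \<one>]
    by (simp add: hom_def)
  have "?\<alpha> \<odot> (runit V (A \<boxtimes> B) \<otimes> idm V \<one>)
      = ?\<alpha> \<odot> (idm V (A \<boxtimes> B) \<otimes> lunit V \<one>) \<odot> assoc V (A \<boxtimes> B) \<one> \<one>"
    by (simp add: triangle)
  also have "\<dots> = (idm V A \<otimes> (idm V B \<otimes> lunit V \<one>)) \<odot> assoc V A B (\<one> \<boxtimes> \<one>)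
      \<odot> assoc V (A \<boxtimes> B) \<one> \<one>"
    by (simp add: cmp_reassoc[OF slide_lunit])
  also have "\<dots> = (idm V A \<otimes> (runit V B \<otimes> idm V \<one>)) \<odot> ?\<alpha>' \<odot> (?\<alpha> \<otimes> idm V \<one>)"
    by (simp add: pentagon interchange_arr_cmp triangle)
  also have "\<dots> = ?\<alpha> \<odot> (((idm V A \<otimes> runit V B) \<odot> ?\<alpha>) \<otimes> idm V \<one>)"
    by (simp add: cmp_reassoc[OF slide_runit[symmetric]] interchange_arr)
  finally show "((idm V A \<otimes> runit V B) \<odot> ?\<alpha>) \<otimes> idm V \<one> = runit V (A \<boxtimes> B) \<otimes> idm V \<one>"
    by - (rule iso_cancel_left[of ?\<alpha>], simp_all)
qed (simp_all add: hom_def)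

lemma runit_inv_tensor:
  assumes [simp]: "A \<in> obj V" "B \<in> obj V"
  shows "assoc V A B \<one> \<odot> inv_arr V (runit V (A \<boxtimes> B)) = idm V A \<otimes> inv_arr V (runit V B)"
proof (rule iso_cancel_right[OF runit_iso])
  have "(idm V A \<otimes> inv_arr V (runit V B)) \<odot> runit V (A \<boxtimes> B) = assoc V A B \<one>"
    by (simp add: interchange_arr_cmp flip: runit_tensor)
  then show "(assoc V A B \<one> \<odot> inv_arr V (runit V (A \<boxtimes> B))) \<odot> runit V (A \<boxtimes> B)
      = (idm V A \<otimes> inv_arr V (runit V B)) \<odot> runit V (A \<boxtimes> B)"
    by simp
qed simp_all

lemma braid_unit_unit: "braid V \<one> \<one> = idm V (\<one> \<boxtimes> \<one>)"
  by (rule iso_cancel_left[of "lunit V \<one>"]) (simp_all add: braid_unit lunit_eq_runit[symmetric])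

lemma braid_points:
  assumes "x \<in> hom V \<one> A" "y \<in> hom V \<one> B"
  shows "braid V A B \<odot> (x \<otimes> y) = y \<otimes> x"
  using homD[OF assms(1)] homD[OF assms(2)]
  by (simp add: braid_natural[OF assms] braid_unit_unit)

end

section \<open>Scalars\<close>

context symmetric_monoidal_category
begin

lemma scalar_mult_hom:
  assumes "s \<in> hom V \<one> \<one>" "f \<in> hom V A B"
  shows "s \<cdot> f \<in> hom V A B"
  using homD[OF assms(1)] homD[OF assms(2)] by (simp add: scalar_mult_def hom_def)

lemma scalar_mult_cmp:
  assumes "s \<in> hom V \<one> \<one>" "f \<in> hom V B C" "g \<in> hom V A B"
  shows "(s \<cdot> f) \<odot> g = s \<cdot> (f \<odot> g)"
  using homD[OF assms(1)] homD[OF assms(2)] homD[OF assms(3)]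
  by (simp add: scalar_mult_def lunit_inv_natural[OF assms(3)] interchange_arr_cmp)

lemma cmp_scalar_mult:
  assumes "s \<in> hom V \<one> \<one>" "f \<in> hom V A B" "g \<in> hom V B C"
  shows "g \<odot> (s \<cdot> f) = s \<cdot> (g \<odot> f)"
  using homD[OF assms(1)] homD[OF assms(2)] homD[OF assms(3)]
  by (simp add: scalar_mult_def cmp_reassoc[OF lunit_natural[OF assms(3), symmetric]]
      interchange_arr_cmp)

lemma scalar_mult_idm_cmp:
  assumes s: "s \<in> hom V \<one> \<one>" and f: "f \<in> hom V A B"
  shows "(s \<cdot> idm V B) \<odot> f = s \<cdot> f"
proof -
  have "idm V B \<in> hom V B B"
    using homD[OF f] by (intro idm_hom) simp
  then show ?thesis
    by (simp only: scalar_mult_cmp[OF s _ f] cmp_idm_left[OF f])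
qed

lemma scalar_mult_left_commute:
  assumes s: "s \<in> hom V \<one> \<one>" and t: "t \<in> hom V \<one> \<one>" and f: "f \<in> hom V A B"
  shows "s \<cdot> t \<cdot> f = t \<cdot> s \<cdot> f"
proof -
  have s_idm: "s \<cdot> idm V B \<in> hom V B B"
    using homD[OF f] by (intro scalar_mult_hom[OF s] idm_hom) simp
  have "s \<cdot> t \<cdot> f = (s \<cdot> idm V B) \<odot> (t \<cdot> f)"
    by (simp only: scalar_mult_idm_cmp[OF s scalar_mult_hom[OF t f]])
  also have "\<dots> = t \<cdot> ((s \<cdot> idm V B) \<odot> f)"
    by (rule cmp_scalar_mult[OF t f s_idm])
  also have "\<dots> = t \<cdot> s \<cdot> f"
    by (simp only: scalar_mult_idm_cmp[OF s f])
  finally show ?thesis .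
qed

lemma cmp_swapped_eigenvectors:
  assumes T: "T \<in> hom V A A" and E: "E \<in> hom V A A"
    and p: "p \<in> hom V B A" and q: "q \<in> hom V B A" and s: "s \<in> hom V \<one> \<one>" and t: "t \<in> hom V \<one> \<one>"
    and Tp: "T \<odot> p = q" and Tq: "T \<odot> q = p" and Ep: "E \<odot> p = s \<cdot> p" and Eq: "E \<odot> q = t \<cdot> q"
  shows "(T \<odot> E \<odot> T) \<odot> E \<odot> p = s \<cdot> t \<cdot> p"
proof -
  note [simp] = homD[OF T] homD[OF E] homD[OF p] homD[OF scalar_mult_hom[OF s p]]
  have "(T \<odot> E \<odot> T) \<odot> E \<odot> p = T \<odot> E \<odot> T \<odot> (s \<cdot> p)"
    by (simp add: Ep)
  also have "\<dots> = s \<cdot> (T \<odot> E \<odot> q)"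
    by (simp only: cmp_scalar_mult[OF s p T] cmp_scalar_mult[OF s q E] Tp
        cmp_scalar_mult[OF s cmp_hom[OF q E] T])
  also have "\<dots> = s \<cdot> t \<cdot> p"
    by (simp only: Eq cmp_scalar_mult[OF t q T] Tq)
  finally show ?thesis .
qed

end

section \<open>Points and effects\<close>

definition adjoin_point :: "('o, 'm, 'b) smc_struct_scheme \<Rightarrow> 'o \<Rightarrow> 'm \<Rightarrow> 'm" where
  "adjoin_point V A p = (idm V A \<otimes>\<^bsub>V\<^esub> p) \<odot>\<^bsub>V\<^esub> inv_arr V (runit V A)"

definition apply_effect :: "('o, 'm, 'b) smc_struct_scheme \<Rightarrow> 'o \<Rightarrow> 'm \<Rightarrow> 'm" where
  "apply_effect V A f = runit V A \<odot>\<^bsub>V\<^esub> (idm V A \<otimes>\<^bsub>V\<^esub> f)"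

lemma Phi_eq_mu_adjoin_point: "Phi V Q F y = mu F \<odot>\<^bsub>V\<^esub> adjoin_point V Q y"
  by (simp add: Phi_def adjoin_point_def)

context symmetric_monoidal_category
begin

lemma adjoin_point_arr [simp]:
  assumes "A \<in> obj V" "p \<in> arr V" "src V p = \<one>"
  shows "adjoin_point V A p \<in> arr V" "src V (adjoin_point V A p) = A"
    "tgt V (adjoin_point V A p) = A \<boxtimes> tgt V p"
  using assms by (simp_all add: adjoin_point_def)

lemma apply_effect_arr [simp]:
  assumes "A \<in> obj V" "f \<in> arr V" "tgt V f = \<one>"
  shows "apply_effect V A f \<in> arr V" "src V (apply_effect V A f) = A \<boxtimes> src V f"
    "tgt V (apply_effect V A f) = A"
  using assms by (simp_all add: apply_effect_def)

lemma adjoin_point_natural: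
  assumes "f \<in> hom V A B" "p \<in> hom V \<one> C"
  shows "adjoin_point V B p \<odot> f = (f \<otimes> idm V C) \<odot> adjoin_point V A p"
  using homD[OF assms(1)] homD[OF assms(2)]
  by (simp add: adjoin_point_def runit_inv_natural[OF assms(1)] interchange_arr_cmp)

lemma adjoin_point_cmp:
  assumes "A \<in> obj V" "p \<in> hom V \<one> B" "f \<in> hom V B C"
  shows "adjoin_point V A (f \<odot> p) = (idm V A \<otimes> f) \<odot> adjoin_point V A p"
  using assms(1) homD[OF assms(2)] homD[OF assms(3)]
  by (simp add: adjoin_point_def interchange_arr_cmp)

lemma adjoin_point_tensor:
  assumes [simp]: "A \<in> obj V" "B \<in> obj V" and p: "p \<in> hom V \<one> C"
  shows "idm V A \<otimes> adjoin_point V B p = assoc V A B C \<odot> adjoin_point V (A \<boxtimes> B) p"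
proof -
  note [simp] = homD[OF p]
  have slide: "assoc V A B C \<odot> (idm V (A \<boxtimes> B) \<otimes> p) = (idm V A \<otimes> (idm V B \<otimes> p)) \<odot> assoc V A B \<one>"
    using assoc_natural[of "idm V A" A A "idm V B" B B p \<one> C] p by (simp add: hom_def)
  show ?thesis
    by (simp add: adjoin_point_def cmp_reassoc[OF slide] runit_inv_tensor interchange_arr)
qed

lemma apply_effect_tensor:
  assumes [simp]: "A \<in> obj V" "B \<in> obj V" and f: "f \<in> hom V C \<one>"
  shows "apply_effect V (A \<boxtimes> B) f = (idm V A \<otimes> apply_effect V B f) \<odot> assoc V A B C"
proof -
  note [simp] = homD[OF f]
  have slide: "assoc V A B \<one> \<odot> (idm V (A \<boxtimes> B) \<otimes> f) = (idm V A \<otimes> (idm V B \<otimes> f)) \<odot> assoc V A B C"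
    using assoc_natural[of "idm V A" A A "idm V B" B B f C \<one>] f by (simp add: hom_def)
  have "apply_effect V (A \<boxtimes> B) f
      = (idm V A \<otimes> runit V B) \<odot> assoc V A B \<one> \<odot> (idm V (A \<boxtimes> B) \<otimes> f)"
    by (simp add: apply_effect_def flip: runit_tensor)
  also have "\<dots> = (idm V A \<otimes> apply_effect V B f) \<odot> assoc V A B C"
    by (simp add: slide apply_effect_def interchange_arr_cmp)
  finally show ?thesis .
qed

lemma adjoin_point_point:
  assumes "x \<in> hom V \<one> A" "y \<in> hom V \<one> B"
  shows "adjoin_point V A y \<odot> x = (x \<otimes> y) \<odot> inv_arr V (lunit V \<one>)"
  using homD[OF assms(1)] homD[OF assms(2)]
  by (simp add: adjoin_point_def runit_inv_natural[OF assms(1)] interchange_arr_cmp lunit_eq_runit)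

lemma apply_effect_points:
  assumes x: "x \<in> hom V \<one> A" and y: "y \<in> hom V \<one> B" and f: "f \<in> hom V B \<one>"
  shows "apply_effect V A f \<odot> (x \<otimes> y) \<odot> inv_arr V (lunit V \<one>) = (f \<odot> y) \<cdot> x"
proof -
  note [simp] = homD[OF x] homD[OF y] homD[OF f]
  have "apply_effect V A f \<odot> (x \<otimes> y) \<odot> inv_arr V (lunit V \<one>)
      = lunit V A \<odot> (braid V A \<one> \<odot> (x \<otimes> (f \<odot> y))) \<odot> inv_arr V (lunit V \<one>)"
    by (simp add: apply_effect_def interchange_arr_cmp cmp_reassoc[OF braid_unit])
  also have "\<dots> = (f \<odot> y) \<cdot> x"
    by (simp only: braid_points[OF x cmp_hom[OF y f]]) (simp add: scalar_mult_def)
  finally show ?thesis .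
qed

lemma effects_exchange:
  assumes "f \<in> hom V B \<one>" "g \<in> hom V A \<one>"
  shows "f \<odot> lunit V B \<odot> (g \<otimes> idm V B) = g \<odot> apply_effect V A f"
proof -
  note [simp] = homD[OF assms(1)] homD[OF assms(2)]
  have "f \<odot> lunit V B \<odot> (g \<otimes> idm V B) = lunit V \<one> \<odot> (g \<otimes> f)"
    by (simp add: cmp_reassoc[OF lunit_natural[OF assms(1), symmetric]] interchange_arr)
  also have "\<dots> = g \<odot> apply_effect V A f"
    by (simp add: apply_effect_def cmp_reassoc[OF runit_natural[OF assms(2), symmetric]]
        interchange_arr lunit_eq_runit)
  finally show ?thesis .
qed

lemma effect_cmp_cap_cup:
  assumes [simp]: "A \<in> obj V" "B \<in> obj V"
    and cap: "cap \<in> hom V (A \<boxtimes> B) \<one>" and cup: "cup \<in> hom V \<one> (B \<boxtimes> C)" and f: "f \<in> hom V C \<one>"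
  shows "f \<odot> lunit V C \<odot> (cap \<otimes> idm V C) \<odot> inv_arr V (assoc V A B C) \<odot> adjoin_point V A cup
      = cap \<odot> adjoin_point V A (apply_effect V B f \<odot> cup)"
proof -
  note [simp] = homD[OF cap] homD[OF cup] homD[OF f]
  have "f \<odot> lunit V C \<odot> (cap \<otimes> idm V C) \<odot> inv_arr V (assoc V A B C) \<odot> adjoin_point V A cup
      = (f \<odot> lunit V C \<odot> (cap \<otimes> idm V C)) \<odot> inv_arr V (assoc V A B C) \<odot> adjoin_point V A cup"
    by simp
  also have "\<dots> = cap \<odot> apply_effect V (A \<boxtimes> B) f \<odot> inv_arr V (assoc V A B C) \<odot> adjoin_point V A cup"
    by (simp only: effects_exchange[OF f cap]) simp
  also have "\<dots> = cap \<odot> (idm V A \<otimes> apply_effect V B f) \<odot> adjoin_point V A cup"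
    by (simp add: apply_effect_tensor[OF _ _ f])
  also have "\<dots> = cap \<odot> adjoin_point V A (apply_effect V B f \<odot> cup)"
    by (simp add: adjoin_point_cmp[OF _ cup] hom_def)
  finally show ?thesis .
qed

end

section \<open>Commutative Frobenius algebras\<close>

definition pairing ::
    "('o, 'm, 'b) smc_struct_scheme \<Rightarrow> 'o \<Rightarrow> 'm frob_struct \<Rightarrow> 'm \<Rightarrow> 'm" where
  "pairing V Q F y = eps F \<odot>\<^bsub>V\<^esub> Phi V Q F y"

definition copyable ::
    "('o, 'm, 'b) smc_struct_scheme \<Rightarrow> 'm frob_struct \<Rightarrow> 'm \<Rightarrow> bool" where
  "copyable V F p \<longleftrightarrow>
     delta F \<odot>\<^bsub>V\<^esub> p = (p \<otimes>\<^bsub>V\<^esub> p) \<odot>\<^bsub>V\<^esub> inv_arr V (lunit V \<one>\<^bsub>V\<^esub>)"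

context comm_frobenius_algebra
begin

lemmas structure_homD [simp] =
  homD[OF mu_hom] homD[OF eta_hom] homD[OF delta_hom] homD[OF eps_hom]

lemma Phi_hom:
  assumes "y \<in> hom V \<one> Q"
  shows "Phi V Q F y \<in> hom V Q Q"
  using homD[OF assms] by (simp add: Phi_def hom_def)

lemma pairing_hom:
  assumes "y \<in> hom V \<one> Q"
  shows "pairing V Q F y \<in> hom V Q \<one>"
  unfolding pairing_def by (rule cmp_hom[OF Phi_hom[OF assms] eps_hom])

lemma Phi_commute:
  assumes x: "x \<in> hom V \<one> Q" and y: "y \<in> hom V \<one> Q"
  shows "Phi V Q F y \<odot> x = Phi V Q F x \<odot> y"
proof -
  note [simp] = homD[OF x] homD[OF y]
  have "Phi V Q F y \<odot> x = mu F \<odot> braid V Q Q \<odot> (x \<otimes> y) \<odot> inv_arr V (lunit V \<one>)"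
    by (simp add: Phi_eq_mu_adjoin_point adjoin_point_point[OF x y] cmp_reassoc[OF mu_comm])
  also have "\<dots> = Phi V Q F x \<odot> y"
    by (simp add: Phi_eq_mu_adjoin_point adjoin_point_point[OF y x]
        cmp_reassoc[OF braid_points[OF x y]])
  finally show ?thesis .
qed

lemma Phi_eta: "Phi V Q F (eta F) = idm V Q"
  by (simp add: Phi_def cmp_reassoc[OF mu_unit_right])

lemma Phi_cmp_eta:
  assumes "y \<in> hom V \<one> Q"
  shows "Phi V Q F y \<odot> eta F = y"
  using homD[OF assms] by (simp add: Phi_commute[OF eta_hom assms] Phi_eta)

lemma pairing_commute:
  assumes x: "x \<in> hom V \<one> Q" and y: "y \<in> hom V \<one> Q"
  shows "pairing V Q F y \<odot> x = pairing V Q F x \<odot> y"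
  using homD[OF x] homD[OF y] homD[OF Phi_hom[OF x]] homD[OF Phi_hom[OF y]]
  by (simp add: pairing_def Phi_commute[OF x y])

lemma pairing_eta: "pairing V Q F (eta F) = eps F"
  by (simp add: pairing_def Phi_eta)

lemma apply_pairing_delta:
  assumes y: "y \<in> hom V \<one> Q"
  shows "apply_effect V Q (pairing V Q F y) \<odot> delta F = Phi V Q F y"
proof -
  note [simp] = homD[OF y]
  have "apply_effect V Q (pairing V Q F y) \<odot> delta F
      = apply_effect V Q (eps F) \<odot> (idm V Q \<otimes> mu F) \<odot> (idm V Q \<otimes> adjoin_point V Q y) \<odot> delta F"
    by (simp add: pairing_def Phi_eq_mu_adjoin_point apply_effect_def interchange_arr_cmp)
  also have "\<dots> = apply_effect V Q (eps F) \<odot> (idm V Q \<otimes> mu F) \<odot> assoc V Q Q Q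
      \<odot> (adjoin_point V (Q \<boxtimes> Q) y \<odot> delta F)"
    by (simp add: adjoin_point_tensor[OF _ _ y])
  also have "\<dots> = apply_effect V Q (eps F)
      \<odot> ((idm V Q \<otimes> mu F) \<odot> assoc V Q Q Q \<odot> (delta F \<otimes> idm V Q)) \<odot> adjoin_point V Q y"
    by (simp add: adjoin_point_natural[OF delta_hom y])
  also have "\<dots> = (apply_effect V Q (eps F) \<odot> delta F) \<odot> mu F \<odot> adjoin_point V Q y"
    by (simp only: frobenius_left) simp
  also have "apply_effect V Q (eps F) \<odot> delta F = idm V Q"
    using delta_counit_right by (simp add: apply_effect_def)
  finally show ?thesis
    by (simp add: Phi_eq_mu_adjoin_point)
qed

lemma pairing_inject:
  assumes x: "x \<in> hom V \<one> Q" and y: "y \<in> hom V \<one> Q"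
    and pairing_eq: "pairing V Q F x = pairing V Q F y"
  shows "x = y"
proof -
  have "Phi V Q F x = Phi V Q F y"
    by (simp only: apply_pairing_delta[OF x, symmetric] apply_pairing_delta[OF y, symmetric]
        pairing_eq)
  then have "Phi V Q F x \<odot> eta F = Phi V Q F y \<odot> eta F"
    by (rule arg_cong)
  then show ?thesis
    by (simp only: Phi_cmp_eta x y)
qed

lemma Phi_copyable:
  assumes p: "p \<in> hom V \<one> Q" and copy: "copyable V F p" and y: "y \<in> hom V \<one> Q"
  shows "Phi V Q F y \<odot> p = (pairing V Q F y \<odot> p) \<cdot> p"
proof -
  note [simp] = homD[OF p] homD[OF pairing_hom[OF y]]
  have "Phi V Q F y \<odot> p = apply_effect V Q (pairing V Q F y) \<odot> delta F \<odot> p"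
    by (simp flip: apply_pairing_delta[OF y])
  also have "\<dots> = apply_effect V Q (pairing V Q F y) \<odot> (p \<otimes> p) \<odot> inv_arr V (lunit V \<one>)"
    using copy by (simp only: copyable_def)
  also have "\<dots> = (pairing V Q F y \<odot> p) \<cdot> p"
    by (rule apply_effect_points[OF p p pairing_hom[OF y]])
  finally show ?thesis .
qed

lemma pairing_cmp_cap_cup:
  assumes G: "comm_frobenius_algebra V Q G" and y: "y \<in> hom V \<one> Q"
  shows "pairing V Q F y \<odot> cap_cup V Q G F = pairing V Q G y"
proof -
  interpret G: comm_frobenius_algebra V Q G by fact
  note [simp] = homD[OF y] homD[OF pairing_hom[OF y]]
  have yank: "apply_effect V Q (pairing V Q F y) \<odot> delta F \<odot> eta F = y"
    by (simp add: cmp_reassoc[OF apply_pairing_delta[OF y]] Phi_cmp_eta[OF y])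
  have "pairing V Q F y \<odot> cap_cup V Q G F = pairing V Q F y \<odot> lunit V Q
      \<odot> ((eps G \<odot> mu G) \<otimes> idm V Q) \<odot> inv_arr V (assoc V Q Q Q)
      \<odot> adjoin_point V Q (delta F \<odot> eta F)"
    by (simp add: cap_cup_def adjoin_point_def)
  also have "\<dots> = (eps G \<odot> mu G)
      \<odot> adjoin_point V Q (apply_effect V Q (pairing V Q F y) \<odot> delta F \<odot> eta F)"
    by (rule effect_cmp_cap_cup) (simp_all add: hom_def)
  also have "\<dots> = pairing V Q G y"
    unfolding yank by (simp add: pairing_def Phi_eq_mu_adjoin_point)
  finally show ?thesis .
qed

lemma copyable_cmp:
  assumes f: "f \<in> hom V Q Q" and copy_f: "delta F \<odot> f = (f \<otimes> f) \<odot> delta F"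
    and p: "p \<in> hom V \<one> Q" and copy_p: "copyable V F p"
  shows "copyable V F (f \<odot> p)"
proof -
  note [simp] = homD[OF f] homD[OF p]
  have "delta F \<odot> f \<odot> p = (f \<otimes> f) \<odot> delta F \<odot> p"
    by (simp add: cmp_reassoc[OF copy_f])
  also have "\<dots> = ((f \<odot> p) \<otimes> (f \<odot> p)) \<odot> inv_arr V (lunit V \<one>)"
    using copy_p by (simp add: copyable_def interchange_arr_cmp)
  finally show ?thesis
    by (simp add: copyable_def)
qed

end

section \<open>GHZ/W-pairs\<close>

lemma plugging_set_eqI:
  assumes "plugging_set V Q P" "A \<in> obj V" "f \<in> hom V Q A" "g \<in> hom V Q A"
    and "\<And>p. p \<in> P \<Longrightarrow> f \<odot>\<^bsub>V\<^esub> p = g \<odot>\<^bsub>V\<^esub> p"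
  shows "f = g"
  using assms unfolding plugging_set_def by blast

context GHZ_W_pair
begin

abbreviation "\<tau> \<equiv> tau V Q G W"

lemma tau_hom: "\<tau> \<in> hom V Q Q"
  by (simp add: tau_def cap_cup_def hom_def)

lemmas tau_homD [simp] = GHZ.homD[OF tau_hom]

lemma tau_eta_hom: "\<tau> \<odot> eta W \<in> hom V \<one> Q"
  by (rule GHZ.cmp_hom[OF W.eta_hom tau_hom])

lemma pairing_cmp_tau:
  assumes "y \<in> hom V \<one> Q"
  shows "pairing V Q G y \<odot> \<tau> = pairing V Q W y"
    and "pairing V Q W y \<odot> \<tau> = pairing V Q G y"
  using GHZ.pairing_cmp_cap_cup[OF W.comm_frobenius_algebra_axioms assms]
    W.pairing_cmp_cap_cup[OF GHZ.comm_frobenius_algebra_axioms assms] alpha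
  by (simp_all only: tau_def)

lemma pairing_cmp_tau_tau:
  assumes x: "x \<in> hom V \<one> Q" and y: "y \<in> hom V \<one> Q"
  shows "pairing V Q G y \<odot> \<tau> \<odot> \<tau> \<odot> x = pairing V Q G y \<odot> x"
proof -
  note [simp] = GHZ.homD[OF x] GHZ.homD[OF GHZ.pairing_hom[OF y]] GHZ.homD[OF W.pairing_hom[OF y]]
  show ?thesis
    by (simp add: GHZ.cmp_reassoc[OF pairing_cmp_tau(1)[OF y]]
        GHZ.cmp_reassoc[OF pairing_cmp_tau(2)[OF y]])
qed

lemma tau_involution:
  assumes plug: "plugging_set V Q P"
  shows "\<tau> \<odot> \<tau> = idm V Q"
proof (rule plugging_set_eqI[OF plug GHZ.carrier_obj])
  have point: "p \<in> hom V \<one> Q" if "p \<in> P" for p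
    using plug that by (auto simp: plugging_set_def)
  fix x assume "x \<in> P"
  then have x: "x \<in> hom V \<one> Q"
    by (rule point)
  note [simp] = GHZ.homD[OF x]
  have tau_tau_x: "\<tau> \<odot> \<tau> \<odot> x \<in> hom V \<one> Q"
    by (simp add: hom_def)
  have "pairing V Q G (\<tau> \<odot> \<tau> \<odot> x) = pairing V Q G x"
  proof (rule plugging_set_eqI[OF plug GHZ.unit_obj
        GHZ.pairing_hom[OF tau_tau_x] GHZ.pairing_hom[OF x]])
    fix y assume "y \<in> P"
    then have y: "y \<in> hom V \<one> Q"
      by (rule point)
    show "pairing V Q G (\<tau> \<odot> \<tau> \<odot> x) \<odot> y = pairing V Q G x \<odot> y"
      by (simp only: GHZ.pairing_commute[OF y] tau_tau_x x pairing_cmp_tau_tau[OF x y])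
  qed
  then have "\<tau> \<odot> \<tau> \<odot> x = x"
    by (rule GHZ.pairing_inject[OF tau_tau_x x])
  then show "(\<tau> \<odot> \<tau>) \<odot> x = idm V Q \<odot> x"
    by simp
qed (simp_all add: hom_def GHZ.carrier_obj)

lemma copyable_eta_W: "copyable V G (eta W)"
  by (simp only: copyable_def beta)

lemma copyable_tau_eta_W: "copyable V G (\<tau> \<odot> eta W)"
  by (rule GHZ.copyable_cmp[OF tau_hom gamma W.eta_hom copyable_eta_W])

lemma Phi_cmp_eta_W:
  assumes y: "y \<in> hom V \<one> Q"
  shows "Phi V Q G y \<odot> eta W = (eps W \<odot> \<tau> \<odot> y) \<cdot> eta W"
proof -
  have "pairing V Q G y \<odot> eta W = pairing V Q G (eta W) \<odot> y"
    by (rule GHZ.pairing_commute[OF W.eta_hom y])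
  also have "\<dots> = (eps W \<odot> \<tau>) \<odot> y"
    using pairing_cmp_tau(2)[OF W.eta_hom] by (simp only: W.pairing_eta)
  also have "\<dots> = eps W \<odot> \<tau> \<odot> y"
    using GHZ.homD[OF y] by simp
  finally show ?thesis
    by (simp only: GHZ.Phi_copyable[OF W.eta_hom copyable_eta_W y])
qed

lemma Phi_cmp_tau_eta_W:
  assumes y: "y \<in> hom V \<one> Q"
  shows "Phi V Q G y \<odot> \<tau> \<odot> eta W = (eps W \<odot> y) \<cdot> (\<tau> \<odot> eta W)"
proof -
  have "pairing V Q G y \<odot> \<tau> \<odot> eta W = pairing V Q W y \<odot> eta W"
    using GHZ.homD[OF GHZ.pairing_hom[OF y]]
    by (simp add: GHZ.cmp_reassoc[OF pairing_cmp_tau(1)[OF y]])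
  also have "\<dots> = eps W \<odot> y"
    by (simp only: W.pairing_commute[OF W.eta_hom y] W.pairing_eta)
  finally show ?thesis
    by (simp only: GHZ.Phi_copyable[OF tau_eta_hom copyable_tau_eta_W y])
qed

lemma Phi_inv_hom:
  assumes "y \<in> hom V \<one> Q"
  shows "Phi_inv V Q G W y \<in> hom V Q Q"
  unfolding Phi_inv_def
  by (rule GHZ.cmp_hom[OF GHZ.cmp_hom[OF tau_hom GHZ.Phi_hom[OF assms]] tau_hom])

lemma Phi_inv_cmp_Phi_plugging_point:
  assumes plug: "plugging_set V Q P" and y: "y \<in> hom V \<one> Q" and p: "p \<in> {eta W, \<tau> \<odot> eta W}"
  shows "Phi_inv V Q G W y \<odot> Phi V Q G y \<odot> p = (eps W \<odot> y) \<cdot> (eps W \<odot> \<tau> \<odot> y) \<cdot> p"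
proof -
  have s: "eps W \<odot> y \<in> hom V \<one> \<one>" and t: "eps W \<odot> \<tau> \<odot> y \<in> hom V \<one> \<one>"
    using GHZ.homD[OF y] by (simp_all add: hom_def)
  have tau_tau_eta: "\<tau> \<odot> \<tau> \<odot> eta W = eta W"
    by (simp add: GHZ.cmp_reassoc[OF tau_involution[OF plug]])
  consider (eta) "p = eta W" | (tau_eta) "p = \<tau> \<odot> eta W"
    using p by blast
  then show ?thesis
  proof cases
    case eta
    then show ?thesis
      using GHZ.cmp_swapped_eigenvectors[OF tau_hom GHZ.Phi_hom[OF y] W.eta_hom tau_eta_hom t s
          refl tau_tau_eta Phi_cmp_eta_W[OF y] Phi_cmp_tau_eta_W[OF y]]
      by (simp only: Phi_inv_def GHZ.scalar_mult_left_commute[OF t s W.eta_hom])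
  next
    case tau_eta
    then show ?thesis
      using GHZ.cmp_swapped_eigenvectors[OF tau_hom GHZ.Phi_hom[OF y] tau_eta_hom W.eta_hom s t
          tau_tau_eta refl Phi_cmp_tau_eta_W[OF y] Phi_cmp_eta_W[OF y]]
      by (simp only: Phi_inv_def)
  qed
qed

end

theorem theorem3p3:
  fixes V :: "('o, 'm, 'b) smc_struct_scheme" (structure)
    and Q :: 'o
    and G W :: "'m frob_struct"
    and \<psi> :: 'm
  assumes "GHZ_W_pair V Q G W"
    and "plugging_set V Q {eta W, tau V Q G W \<odot> eta W}"
    and "\<psi> \<in> hom V \<one> Q"
  shows "Phi_inv V Q G W \<psi> \<odot> Phi V Q G \<psi> =
         (eps W \<odot> \<psi>) \<cdot> (eps W \<odot> tau V Q G W \<odot> \<psi>) \<cdot> idm V Q"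
proof -
  interpret GHZ_W_pair V Q G W by fact
  note plug = assms(2) and psi = assms(3)
  let ?s = "eps W \<odot> \<psi>" and ?t = "eps W \<odot> \<tau> \<odot> \<psi>"
  have s: "?s \<in> hom V \<one> \<one>" and t: "?t \<in> hom V \<one> \<one>"
    using GHZ.homD[OF psi] by (simp_all add: hom_def)
  have t_idm: "?t \<cdot> idm V Q \<in> hom V Q Q"
    by (rule GHZ.scalar_mult_hom[OF t GHZ.idm_hom[OF GHZ.carrier_obj]])
  show ?thesis
  proof (rule plugging_set_eqI[OF plug GHZ.carrier_obj _ GHZ.scalar_mult_hom[OF s t_idm]])
    show "Phi_inv V Q G W \<psi> \<odot> Phi V Q G \<psi> \<in> hom V Q Q"
      by (rule GHZ.cmp_hom[OF GHZ.Phi_hom[OF psi] Phi_inv_hom[OF psi]])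
    fix p assume p: "p \<in> {eta W, \<tau> \<odot> eta W}"
    then have p_hom: "p \<in> hom V \<one> Q"
      using W.eta_hom tau_eta_hom by blast
    have "(Phi_inv V Q G W \<psi> \<odot> Phi V Q G \<psi>) \<odot> p = ?s \<cdot> ?t \<cdot> p"
      by (simp only: GHZ.cmp_assoc[OF p_hom GHZ.Phi_hom[OF psi] Phi_inv_hom[OF psi]]
          Phi_inv_cmp_Phi_plugging_point[OF plug psi p])
    then show "(Phi_inv V Q G W \<psi> \<odot> Phi V Q G \<psi>) \<odot> p = (?s \<cdot> ?t \<cdot> idm V Q) \<odot> p"
      by (simp only: GHZ.scalar_mult_cmp[OF s t_idm p_hom] GHZ.scalar_mult_idm_cmp[OF t p_hom])
  qed
qed

end
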